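(* Let $n$ and $r$ be positive integers and $K$ a set of positive integers. If there exists a PBD$(n,K)$ and, for every $k\in K$, there exists an $r$-IPC$(k,k-1)$, then there exists an $r$-IPC$(n,n-1)$.
   Context: For permutations $\sigma,\tau$ of an $n$-element set, the Hamming distance is the number of points $x$ with $\sigma(x)\neq\tau(x)$. A permutation code PC$(n,d)$ is a set of permutations of an $n$-element set in which any two distinct elements are at Hamming distance at least $d$. A permutation code is idempotent if each of its words has exactly one fixed point. An $r$-IPC$(n,n-1)$ is an idempotent PC$(n,n-1)$ on an $n$-element symbol set in which every symbol is the fixed point of exactly $r$ words. A pairwise balanced design PBD$(n,K)$ is a pair $(V,\mathcal{B})$ where $|V|=n$, $\mathcal{B}$ is a family of subsets (blocks) of $V$ whose sizes lie in $K$, and every pair of distinct elements of $V$ lies in exactly one block.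
   Formalization: The case n = 1 with r ≥ 2 is excluded, since there the claim is false: a single point with no blocks is a PBD(1,K) (e.g. K empty), but the identity is the only permutation of one point, so no r-IPC(1,0) exists for r ≥ 2. *)

theory Defs
  imports "HOL-Combinatorics.Permutations"
begin

definition hamming_dist :: "'a set \<Rightarrow> ('a \<Rightarrow> 'a) \<Rightarrow> ('a \<Rightarrow> 'a) \<Rightarrow> nat" where
  "hamming_dist S \<sigma> \<tau> = card {x \<in> S. \<sigma> x \<noteq> \<tau> x}"

(* A permutation of S is a function on the whole type that is the identity outside S
   (permutes), so distinct words differ at some point of S. *)
definition is_PC :: "nat \<Rightarrow> nat \<Rightarrow> 'a set \<Rightarrow> ('a \<Rightarrow> 'a) set \<Rightarrow> bool" where
  "is_PC n d S C \<longleftrightarrow>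
     finite S \<and> card S = n \<and>
     (\<forall>\<sigma>\<in>C. \<sigma> permutes S) \<and>
     (\<forall>\<sigma>\<in>C. \<forall>\<tau>\<in>C. \<sigma> \<noteq> \<tau> \<longrightarrow> d \<le> hamming_dist S \<sigma> \<tau>)"

definition idempotent_code :: "'a set \<Rightarrow> ('a \<Rightarrow> 'a) set \<Rightarrow> bool" where
  "idempotent_code S C \<longleftrightarrow> (\<forall>\<sigma>\<in>C. \<exists>!x. x \<in> S \<and> \<sigma> x = x)"

definition is_IPC :: "nat \<Rightarrow> nat \<Rightarrow> nat \<Rightarrow> 'a set \<Rightarrow> ('a \<Rightarrow> 'a) set \<Rightarrow> bool" where
  "is_IPC r n d S C \<longleftrightarrow>
     is_PC n d S C \<and> idempotent_code S C \<and>
     (\<forall>x\<in>S. card {\<sigma> \<in> C. \<sigma> x = x} = r)"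

definition is_PBD :: "nat \<Rightarrow> nat set \<Rightarrow> 'a set \<Rightarrow> 'a set set \<Rightarrow> bool" where
  "is_PBD n K V \<B> \<longleftrightarrow>
     finite V \<and> card V = n \<and>
     (\<forall>B\<in>\<B>. B \<subseteq> V \<and> card B \<in> K) \<and>
     (\<forall>x\<in>V. \<forall>y\<in>V. x \<noteq> y \<longrightarrow> (\<exists>!B. B \<in> \<B> \<and> x \<in> B \<and> y \<in> B))"

(* The one-point case is degenerate: the empty block family is a PBD(1,K) for every K, while
   the only permutation of a point is the identity, so an r-IPC(1,0) forces r = 1.
   Hence PBD closure fails for n = 1, r > 1 (e.g. with K empty). *)
lemma is_PBD_singleton: "is_PBD 1 K {x} {}"
  by (simp add: is_PBD_def)

lemma is_IPC_one_imp:
  assumes "is_IPC r 1 d S C" and "0 < r"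
  shows "r = 1"
proof -
  from assms obtain x where S: "S = {x}"
    unfolding is_IPC_def is_PC_def by (metis card_1_singletonE)
  have "\<sigma> = id" if "\<sigma> \<in> C" for \<sigma>
    using that assms S unfolding is_IPC_def is_PC_def by (metis permutes_sing)
  hence "{\<sigma> \<in> C. \<sigma> x = x} \<subseteq> {id}" by blast
  hence "card {\<sigma> \<in> C. \<sigma> x = x} \<le> card {id :: 'a \<Rightarrow> 'a}" by (intro card_mono) auto
  thus ?thesis using assms S by (auto simp: is_IPC_def)
qed

end

(* Fix a symbol x. The blocks through x partition the other symbols, so choosing in the code of
   each such block a word that fixes x and gluing these words gives a permutation of V whose only
   fixed point is x; the r words available in every block give r permutations for each x.
   If the permutations glued at x and at y agree at z, then z and its common image lie both in
   the block through x, z and in the block through y, z, so these blocks coincide with the block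
   through x and y, where two distinct words agree at most once. *)
theory Submission
  imports Defs
begin

text \<open>The points of agreement and of disagreement partition \<open>S\<close>, so the distance
  bound allows at most one agreement. For empty \<open>S\<close> the truncated subtraction makes
  both sides true.\<close>

lemma hamming_dist_ge_iff:
  assumes "finite S"
  shows "card S - 1 \<le> hamming_dist S \<sigma> \<tau> \<longleftrightarrow>
    (\<forall>a\<in>S. \<forall>b\<in>S. \<sigma> a = \<tau> a \<longrightarrow> \<sigma> b = \<tau> b \<longrightarrow> a = b)"
proof -
  have "card S = card {x \<in> S. \<sigma> x \<noteq> \<tau> x} + card {x \<in> S. \<sigma> x = \<tau> x}"
    using assms by (subst card_Un_disjoint[symmetric]) (auto intro: arg_cong[where f = card])
  then have "card S - 1 \<le> hamming_dist S \<sigma> \<tau> \<longleftrightarrow> card {x \<in> S. \<sigma> x = \<tau> x} \<le> Suc 0"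
    unfolding hamming_dist_def by linarith
  also have "\<dots> \<longleftrightarrow> (\<forall>a\<in>S. \<forall>b\<in>S. \<sigma> a = \<tau> a \<longrightarrow> \<sigma> b = \<tau> b \<longrightarrow> a = b)"
    using assms by (subst card_le_Suc0_iff_eq) auto
  finally show ?thesis .
qed

text \<open>This is the working form of the notion: the distance condition becomes the rule that two
  words agreeing at two distinct points are equal.\<close>

lemma is_IPC_iff:
  "is_IPC r k (k - 1) S C \<longleftrightarrow> finite S \<and> card S = k \<and> (\<forall>\<sigma>\<in>C. \<sigma> permutes S) \<and>
    (\<forall>\<sigma>\<in>C. \<forall>\<tau>\<in>C. \<forall>a\<in>S. \<forall>b\<in>S. \<sigma> a = \<tau> a \<longrightarrow> \<sigma> b = \<tau> b \<longrightarrow> a \<noteq> b \<longrightarrow> \<sigma> = \<tau>) \<and>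
    (\<forall>\<sigma>\<in>C. \<exists>!x. x \<in> S \<and> \<sigma> x = x) \<and> (\<forall>x\<in>S. card {\<sigma> \<in> C. \<sigma> x = x} = r)"
proof -
  have "(\<forall>\<sigma>\<in>C. \<forall>\<tau>\<in>C. \<sigma> \<noteq> \<tau> \<longrightarrow> k - 1 \<le> hamming_dist S \<sigma> \<tau>) \<longleftrightarrow>
    (\<forall>\<sigma>\<in>C. \<forall>\<tau>\<in>C. \<forall>a\<in>S. \<forall>b\<in>S. \<sigma> a = \<tau> a \<longrightarrow> \<sigma> b = \<tau> b \<longrightarrow> a \<noteq> b \<longrightarrow> \<sigma> = \<tau>)"
    if "finite S" "card S = k"
    using hamming_dist_ge_iff[OF that(1)] that(2) by blast
  then show ?thesis
    unfolding is_IPC_def is_PC_def idempotent_code_def by argo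
qed

text \<open>Conjugation by a bijection carries agreements to agreements and fixed points to fixed
  points. It moves a code given on an arbitrary set of the right size onto a prescribed
  block.\<close>

lemma is_IPC_transport:
  assumes IPC: "is_IPC r k (k - 1) S C" and f: "bij_betw f S T"
  shows "is_IPC r k (k - 1) T (map_permutation S f ` C)"
proof -
  have S: "finite S" "card S = k" and perm: "\<And>\<sigma>. \<sigma> \<in> C \<Longrightarrow> \<sigma> permutes S"
    and agree: "\<And>\<sigma> \<tau> a b. \<lbrakk>\<sigma> \<in> C; \<tau> \<in> C; a \<in> S; b \<in> S; \<sigma> a = \<tau> a; \<sigma> b = \<tau> b; a \<noteq> b\<rbrakk> \<Longrightarrow> \<sigma> = \<tau>"
    and fixp: "\<And>\<sigma>. \<sigma> \<in> C \<Longrightarrow> \<exists>!x. x \<in> S \<and> \<sigma> x = x"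
    and fix_card: "\<And>x. x \<in> S \<Longrightarrow> card {\<sigma> \<in> C. \<sigma> x = x} = r"
    using IPC unfolding is_IPC_iff by blast+
  have inj: "inj_on f S" and T: "f ` S = T"
    using f by (auto simp: bij_betw_def)
  let ?m = "map_permutation S f"
  have val: "?m \<sigma> (f a) = f (\<sigma> a)" if "a \<in> S" for \<sigma> a
    using that inj by (simp add: map_permutation_apply)
  have eq_iff: "f a = f b \<longleftrightarrow> a = b" if "a \<in> S" "b \<in> S" for a b
    using inj that by (auto dest: inj_onD)
  have in_S: "\<sigma> a \<in> S" if "\<sigma> \<in> C" "a \<in> S" for \<sigma> a
    using perm that by (simp add: permutes_in_image)
  \<comment> \<open>Distinct words must stay distinct, or the number of words fixing a point could
    drop. Off \<open>S\<close> all words are the identity, so comparing them on \<open>S\<close>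
    suffices.\<close>
  have m_inj: "inj_on ?m C"
  proof (rule inj_onI)
    fix \<sigma> \<tau> assume *: "\<sigma> \<in> C" "\<tau> \<in> C" "?m \<sigma> = ?m \<tau>"
    have "\<sigma> a = \<tau> a" for a
    proof (cases "a \<in> S")
      case True
      then have "f (\<sigma> a) = f (\<tau> a)" using * val by metis
      then show ?thesis using eq_iff in_S * True by blast
    next
      case False
      then show ?thesis using perm * by (metis permutes_not_in)
    qed
    then show "\<sigma> = \<tau>" by blast
  qed
  have "?m \<sigma> permutes T" if "\<sigma> \<in> C" for \<sigma>
    using map_permutation_permutes[OF f perm[OF that]] .
  moreover have "?m \<sigma> = ?m \<tau>"
    if "\<sigma> \<in> C" "\<tau> \<in> C" "a \<in> T" "b \<in> T" "?m \<sigma> a = ?m \<tau> a" "?m \<sigma> b = ?m \<tau> b" "a \<noteq> b" for \<sigma> \<tau> a b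
  proof -
    obtain a' b' where "a' \<in> S" "b' \<in> S" "a = f a'" "b = f b'"
      using \<open>a \<in> T\<close> \<open>b \<in> T\<close> T by blast
    then have "\<sigma> = \<tau>"
      using that agree[of \<sigma> \<tau> a' b'] val eq_iff in_S by metis
    then show ?thesis by simp
  qed
  moreover have "\<exists>!x. x \<in> T \<and> ?m \<sigma> x = x" if "\<sigma> \<in> C" for \<sigma>
    using fixp[OF that] that T val eq_iff in_S by (smt (verit, best) image_iff)
  moreover have "card {\<sigma> \<in> ?m ` C. \<sigma> x = x} = r" if "x \<in> T" for x
  proof -
    obtain y where y: "y \<in> S" "x = f y"
      using \<open>x \<in> T\<close> T by blast
    have "{\<sigma> \<in> ?m ` C. \<sigma> x = x} = ?m ` {\<sigma> \<in> C. \<sigma> y = y}"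
      using y val eq_iff in_S by auto
    also have "card \<dots> = card {\<sigma> \<in> C. \<sigma> y = y}"
      using m_inj by (intro card_image) (auto intro: inj_on_subset)
    finally show ?thesis using fix_card y by simp
  qed
  moreover have "finite T" "card T = k"
    using S bij_betw_finite[OF f] bij_betw_same_card[OF f] by simp_all
  ultimately show ?thesis
    unfolding is_IPC_iff by blast
qed

lemma is_IPC_PBD_closure:
  fixes V :: "'a set"
  assumes PBD: "is_PBD n K V \<B>" and n: "n > 1" and r: "r > 0"
    and codes: "\<And>B. B \<in> \<B> \<Longrightarrow> \<exists>C. is_IPC r (card B) (card B - 1) B C"
  shows "\<exists>C. is_IPC r n (n - 1) V C"
proof -
  have V: "finite V" "card V = n" and sub: "\<And>B. B \<in> \<B> \<Longrightarrow> B \<subseteq> V"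
    and pair: "\<And>x y. \<lbrakk>x \<in> V; y \<in> V; x \<noteq> y\<rbrakk> \<Longrightarrow> \<exists>!B. B \<in> \<B> \<and> x \<in> B \<and> y \<in> B"
    using PBD unfolding is_PBD_def by blast+
  \<comment> \<open>\<open>b x y\<close> will be the block through \<open>x\<close> and
    \<open>y\<close>; it is unconstrained when \<open>x = y\<close> or a point lies outside
    \<open>V\<close>.\<close>
  have "\<forall>x y. \<exists>B. x \<in> V \<and> y \<in> V \<and> x \<noteq> y \<longrightarrow> B \<in> \<B> \<and> x \<in> B \<and> y \<in> B"
    using pair by blast
  then obtain b where b: "\<And>x y. \<lbrakk>x \<in> V; y \<in> V; x \<noteq> y\<rbrakk> \<Longrightarrow> b x y \<in> \<B> \<and> x \<in> b x y \<and> y \<in> b x y"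
    by metis
  have b_eq: "b x y = B" if "B \<in> \<B>" "x \<in> B" "y \<in> B" "x \<noteq> y" for x y B
    using that pair[of x y] b[of x y] sub by blast
  obtain D where D: "\<And>B. B \<in> \<B> \<Longrightarrow> is_IPC r (card B) (card B - 1) B (D B)"
    using codes by metis
  have perm: "\<And>B \<sigma>. \<lbrakk>B \<in> \<B>; \<sigma> \<in> D B\<rbrakk> \<Longrightarrow> \<sigma> permutes B"
    and agree: "\<And>B \<sigma> \<tau> u v. \<lbrakk>B \<in> \<B>; \<sigma> \<in> D B; \<tau> \<in> D B; u \<in> B; v \<in> B; \<sigma> u = \<tau> u; \<sigma> v = \<tau> v; u \<noteq> v\<rbrakk>
      \<Longrightarrow> \<sigma> = \<tau>"
    and fixp: "\<And>B \<sigma> u v. \<lbrakk>B \<in> \<B>; \<sigma> \<in> D B; u \<in> B; v \<in> B; \<sigma> u = u; \<sigma> v = v\<rbrakk> \<Longrightarrow> u = v"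
    and fix_card: "\<And>B x. \<lbrakk>B \<in> \<B>; x \<in> B\<rbrakk> \<Longrightarrow> card {\<sigma> \<in> D B. \<sigma> x = x} = r"
    using D unfolding is_IPC_iff by blast+
  \<comment> \<open>\<open>w B x\<close> numbers the words of \<open>D B\<close> that fix
    \<open>x\<close> by the indices below \<open>r\<close>, so that one index \<open>i\<close>
    selects a word in every block through \<open>x\<close> at once.\<close>
  define w where "w B x = (SOME h. bij_betw h {..<r} {\<sigma> \<in> D B. \<sigma> x = x})" for B x
  have w: "bij_betw (w B x) {..<r} {\<sigma> \<in> D B. \<sigma> x = x}" if "B \<in> \<B>" "x \<in> B" for B x
  proof -
    have "card {\<sigma> \<in> D B. \<sigma> x = x} = r"
      using that by (rule fix_card)
    \<comment> \<open>An infinite set has \<open>card\<close> 0, so positivity of \<open>r\<close>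
      yields finiteness.\<close>
    moreover from this have "finite {\<sigma> \<in> D B. \<sigma> x = x}"
      using r by (intro card_ge_0_finite) simp
    ultimately have "\<exists>h. bij_betw h {..<r} {\<sigma> \<in> D B. \<sigma> x = x}"
      using ex_bij_betw_nat_finite lessThan_atLeast0 by metis
    then show ?thesis
      unfolding w_def by (rule someI_ex)
  qed
  have w_D: "w B x i \<in> D B" and w_fix: "w B x i x = x"
    if "B \<in> \<B>" "x \<in> B" "i < r" for B x i
    using bij_betwE[OF w[OF that(1,2)]] that(3) by blast+
  have w_inj: "i = j" if "B \<in> \<B>" "x \<in> B" "i < r" "j < r" "w B x i = w B x j" for B x i j
    using bij_betw_imp_inj_on[OF w[OF that(1,2)]] that by (auto dest: inj_onD)
  \<comment> \<open>This glues the \<open>i\<close>-th words of all blocks through \<open>x\<close>.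
    The default value \<open>y\<close> fixes \<open>x\<close> and gives the identity outside
    \<open>V\<close>, as \<open>permutes\<close> demands.\<close>
  define g where "g x i y = (if y \<in> V \<and> y \<noteq> x then w (b x y) x i y else y)" for x i y
  have g_self: "g x i x = x" for x i
    by (simp add: g_def)
  have g_block: "g x i y = w B x i y" "g x i y \<in> B" "g x i y \<noteq> y" "g x i y \<noteq> x"
    if "B \<in> \<B>" "x \<in> B" "y \<in> B" "x \<noteq> y" "i < r" for B x y i
  proof -
    show eq: "g x i y = w B x i y"
      using that b_eq[of B x y] sub by (auto simp: g_def)
    have p: "w B x i permutes B"
      using perm w_D that by blast
    show "g x i y \<in> B"
      unfolding eq using p that by (simp add: permutes_in_image)
    \<comment> \<open>The word \<open>w B x i\<close> already fixes \<open>x\<close> and has only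
      one fixed point.\<close>
    show "g x i y \<noteq> y"
      unfolding eq using fixp[of B "w B x i" x y] w_D w_fix that by blast
    show "g x i y \<noteq> x"
      unfolding eq using p w_fix that by (metis permutes_inj injD)
  qed
  have g_permutes: "g x i permutes V" if x: "x \<in> V" and i: "i < r" for x i
  proof (rule bij_imp_permutes)
    have maps: "g x i y \<in> V" if "y \<in> V" for y
      using g_block(2)[of "b x y" x y i] b[of x y] x i that sub g_self by (cases "x = y") auto
    have "inj_on (g x i) V"
    proof (rule inj_onI)
      fix y z assume yz: "y \<in> V" "z \<in> V" "g x i y = g x i z"
      show "y = z"
      proof (cases "y = x \<or> z = x")
        case True
        then show ?thesis
          using g_block(4)[of "b x y" x y i] g_block(4)[of "b x z" x z i] b[of x y] b[of x z]
            g_self x i yz by metis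
      next
        case False
        let ?B = "b x y"
        have By: "?B \<in> \<B>" "x \<in> ?B" "y \<in> ?B" and Bz: "b x z \<in> \<B>" "x \<in> b x z" "z \<in> b x z"
          using b x yz False by metis+
        \<comment> \<open>The common image of \<open>y\<close> and \<open>z\<close> differs from
          \<open>x\<close> and lies with \<open>x\<close> in both blocks, so the blocks coincide and
          injectivity of a single word finishes the case.\<close>
        have "b x z = ?B"
          using b_eq[of ?B x "g x i y"] b_eq[of "b x z" x "g x i y"] g_block[OF By] g_block[OF Bz]
            By Bz i False yz by metis
        then have "w ?B x i y = w ?B x i z"
          using g_block(1)[OF By] g_block(1)[OF Bz] i False yz by metis
        then show ?thesis
          using perm[OF By(1) w_D[OF By(1,2) i]] by (meson permutes_inj injD)
      qed
    qed
    moreover have "g x i ` V \<subseteq> V" using maps by blast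
    ultimately show "bij_betw (g x i) V V"
      using V(1) by (simp add: bij_betw_def endo_inj_surj)
  qed (simp add: g_def)
  have g_fix: "g x i y = y \<longleftrightarrow> y = x" if "x \<in> V" "y \<in> V" "i < r" for x y i
    using g_block(3)[of "b x y" x y i] b[of x y] that g_self by metis
  have g_agree_same: "i = j"
    if "x \<in> V" "u \<in> V" "u \<noteq> x" "i < r" "j < r" "g x i u = g x j u" for x u i j
  proof -
    let ?B = "b x u"
    have B: "?B \<in> \<B>" "x \<in> ?B" "u \<in> ?B" using b that by metis+
    \<comment> \<open>These two words agree at \<open>u\<close> and also at their common fixed point
      \<open>x\<close>.\<close>
    have "w ?B x i = w ?B x j"
      using agree[OF B(1) w_D w_D, of x i x j x u] g_block(1)[OF B] w_fix B that by metis
    then show ?thesis using w_inj B that by blast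
  qed
  have g_agree_block: "u \<in> b x y \<and> w (b x y) x i u = w (b x y) y j u"
    if "x \<in> V" "y \<in> V" "x \<noteq> y" "u \<in> V" "i < r" "j < r" "g x i u = g y j u" for x y u i j
  proof -
    \<comment> \<open>At \<open>x\<close> the first permutation takes the value \<open>x\<close> but
      the second, fixing only \<open>y\<close>, does not; symmetrically at \<open>y\<close>.\<close>
    have "u \<noteq> x" "u \<noteq> y" using g_fix g_self that by metis+
    then have B: "b x u \<in> \<B>" "x \<in> b x u" "u \<in> b x u" and B': "b y u \<in> \<B>" "y \<in> b y u" "u \<in> b y u"
      using b that by metis+
    \<comment> \<open>Both blocks contain \<open>u\<close> and its common image, which is a
      different symbol.\<close>
    have "b y u = b x u"
      using b_eq[of "b x u" u "g x i u"] b_eq[of "b y u" u "g x i u"]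
        g_block[OF B] g_block[OF B'] B B' \<open>u \<noteq> x\<close> \<open>u \<noteq> y\<close> that by metis
    moreover from this have "b x y = b x u"
      using b_eq[of "b x u" x y] B B' that by metis
    ultimately show ?thesis
      using g_block(1)[OF B] g_block(1)[OF B'] B \<open>u \<noteq> x\<close> \<open>u \<noteq> y\<close> that by metis
  qed
  define C where "C = {g x i | x i. x \<in> V \<and> i < r}"
  have "\<sigma> = \<tau>"
    if st: "\<sigma> \<in> C" "\<tau> \<in> C" and uv: "u \<in> V" "v \<in> V" "\<sigma> u = \<tau> u" "\<sigma> v = \<tau> v" "u \<noteq> v" for \<sigma> \<tau> u v
  proof -
    obtain x i y j where \<sigma>: "\<sigma> = g x i" "x \<in> V" "i < r" and \<tau>: "\<tau> = g y j" "y \<in> V" "j < r"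
      using st unfolding C_def by blast
    show ?thesis
    proof (cases "x = y")
      case True
      then show ?thesis using g_agree_same \<sigma> \<tau> uv by metis
    next
      case False
      let ?B = "b x y"
      have B: "?B \<in> \<B>" "x \<in> ?B" "y \<in> ?B" using b \<sigma> \<tau> False by metis+
      have "u \<in> ?B \<and> w ?B x i u = w ?B y j u" "v \<in> ?B \<and> w ?B x i v = w ?B y j v"
        using g_agree_block \<sigma> \<tau> False uv by metis+
      \<comment> \<open>Two agreements inside one block force the words to be equal; this single
        word would then fix both \<open>x\<close> and \<open>y\<close>, against idempotence.\<close>
      then have "w ?B x i = w ?B y j"
        using agree[OF B(1) w_D w_D, of x i y j u v] B \<sigma> \<tau> uv by metis
      then have "x = y"
        using fixp[of ?B "w ?B x i" x y] w_D w_fix B \<sigma> \<tau> by metis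
      then show ?thesis using False by blast
    qed
  qed
  moreover have "card {\<sigma> \<in> C. \<sigma> x = x} = r" if x: "x \<in> V" for x
  proof -
    \<comment> \<open>All \<open>g x i\<close> agree at \<open>x\<close>, so a second symbol is
      needed to tell the \<open>r\<close> permutations apart; here \<open>n > 1\<close>
      enters.\<close>
    obtain u where u: "u \<in> V" "u \<noteq> x"
      using V n x by (metis card_le_Suc0_iff_eq One_nat_def not_less)
    \<comment> \<open>A permutation glued at another symbol \<open>y\<close> fixes only
      \<open>y\<close>, so it does not contribute here.\<close>
    have "{\<sigma> \<in> C. \<sigma> x = x} = g x ` {..<r}"
      using x g_fix g_self unfolding C_def by auto
    moreover have "inj_on (g x) {..<r}"
      using g_agree_same[OF x u] by (auto intro!: inj_onI)
    ultimately show ?thesis by (simp add: card_image)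
  qed
  moreover have "\<exists>!x. x \<in> V \<and> \<sigma> x = x" if "\<sigma> \<in> C" for \<sigma>
    using that g_fix unfolding C_def by blast
  moreover have "\<sigma> permutes V" if "\<sigma> \<in> C" for \<sigma>
    using that g_permutes unfolding C_def by blast
  ultimately have "is_IPC r n (n - 1) V C"
    unfolding is_IPC_iff using V by blast
  then show ?thesis ..
qed

text \<open>The assumption \<open>n = 1 \<Longrightarrow> r = 1\<close> excludes the degenerate
  one-point case, where the conclusion fails. Every finite set is in bijection with a set of
  naturals, so symbols of type \<open>nat\<close> lose no generality.\<close>

theorem theorem3p1:
  fixes n r :: nat and K :: "nat set"
  assumes "n > 0" and "r > 0" and "\<forall>k\<in>K. k > 0"
    and "n = 1 \<Longrightarrow> r = 1"
    and "\<exists>(V :: nat set) \<B>. is_PBD n K V \<B>"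
    and "\<forall>k\<in>K. \<exists>(S :: nat set) C. is_IPC r k (k - 1) S C"
  shows "\<exists>(S :: nat set) C. is_IPC r n (n - 1) S C"
proof (cases "n = 1")
  case True
  then have "r = 1" using assms(4) by blast
  have id_fix: "{\<sigma>. \<sigma> = id \<and> \<sigma> (0::nat) = 0} = {id}" by force
  \<comment> \<open>The only permutation of a point is the identity, and it is the one word
    required.\<close>
  have "is_IPC r n (n - 1) {0::nat} {id}"
    using True \<open>r = 1\<close>
    by (simp add: id_fix is_IPC_def is_PC_def idempotent_code_def)
  then show ?thesis by blast
next
  case False
  obtain V :: "nat set" and \<B> where PBD: "is_PBD n K V \<B>"
    using assms(5) by blast
  have "\<exists>C. is_IPC r (card B) (card B - 1) B C" if "B \<in> \<B>" for B
  proof -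
    have "finite B" "card B \<in> K"
      using PBD that by (auto simp: is_PBD_def intro: finite_subset)
    \<comment> \<open>The given code lives on some set \<open>S\<close> of the size of
      \<open>B\<close>; any bijection from \<open>S\<close> to \<open>B\<close> relabels its
      symbols.\<close>
    then obtain S :: "nat set" and C where C: "is_IPC r (card B) (card B - 1) S C"
      using assms(6) by blast
    then have "finite S" "card S = card B"
      by (simp_all add: is_IPC_def is_PC_def)
    then obtain f where "bij_betw f S B"
      using finite_same_card_bij \<open>finite B\<close> by blast
    then show ?thesis using is_IPC_transport[OF C] by blast
  qed
  moreover have "n > 1"
    using False assms(1) by simp
  ultimately show ?thesis
    using is_IPC_PBD_closure[OF PBD _ assms(2)] by blast
qed

end
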